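(* Let $D$ be a compact nonempty subset of $\mathbb{R}^d$. Let $Y$ be a Gaussian process on $D$ with mean zero and continuous covariance function $k$. Let $(x_{ni})_{1\le i\le n,\,n\in\mathbb{N}}$ be a triangular array of observation points such that $x_{ni}\in D$ for all $1\le i\le n$, $n\in\mathbb{N}$, and such that for all $x\in D$, $\lim_{n\to\infty}\min_{i=1,\dots,n}\|x_{ni}-x\|=0$. For $n\in\mathbb{N}$, let $X=(x_{n1},\dots,x_{nn})^t$, and let $M_1(x),\dots,M_{p_n}(x)$ be any collection of $p_n$ Kriging predictors based on respective design points $X_1,\dots,X_{p_n}$, where each $X_i$ is a subset of (the rows of) $X$ and $M_i(x)=k(x,X_i)k(X_i,X_i)^{-1}Y(X_i)$ for $i=1,\dots,p_n$. Assume that each row of $X$ is a row of at least one $X_i$, $1\le i\le p_n$. Let $M_{\mathcal{A}}(x)$ be the nested Kriging predictor, i.e. the best linear predictor of $Y(x)$ from $M_1(x),\dots,M_{p_n}(x)$. Then $$\sup_{x\in D}\mathrm{E}\big[(Y(x)-M_{\mathcal{A}}(x))^2\big]\to 0\quad\text{as } n\to\infty.$$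
   Context: Notation: for matrices $A,B$ whose rows are points $a_i^t$, $b_j^t$ of $D$, $k(A,B)$ is the matrix with entries $k(a_i,b_j)$, and $Y(A)$ is the column vector with entries $Y(a_i)$. The matrices $k(X_i,X_i)$ are assumed invertible. Nested Kriging predictor: with $M(x)=(M_1(x),\dots,M_{p}(x))^t$ ($p=p_n$), $K_M(x)$ the $p\times p$ covariance matrix of $M(x)$ and $k_M(x)$ the $p\times1$ vector with entries $\mathrm{Cov}[M_i(x),Y(x)]$, the best linear predictor of $Y(x)$ from $M_1(x),\dots,M_p(x)$ (the linear combination of the $M_i(x)$ minimizing the mean square error) is $M_{\mathcal{A}}(x)=k_M(x)^tK_M(x)^{-1}M(x)$; it is a standing assumption that $K_M(x)$ is invertible for all $x\in D$. *)

theory Defs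
  imports "HOL-Probability.Probability" "Jordan_Normal_Form.Gauss_Jordan_Elimination"
begin

(* The case of a zero standard deviation is an almost surely constant variable: degenerate
   marginals are allowed, since a covariance function need only be positive semidefinite. *)
definition gaussian_rv :: "'w measure \<Rightarrow> ('w \<Rightarrow> real) \<Rightarrow> bool" where
  "gaussian_rv P Z \<longleftrightarrow> Z \<in> borel_measurable P \<and>
     (\<exists>m. (AE w in P. Z w = m) \<or>
          (\<exists>s>0. distributed P lborel Z (\<lambda>t. ennreal (normal_density m s t))))"

definition gaussian_process :: "'w measure \<Rightarrow> 'a set \<Rightarrow> ('a \<Rightarrow> 'w \<Rightarrow> real) \<Rightarrow> bool" where
  "gaussian_process P D Y \<longleftrightarrow> prob_space P \<and>
     (\<forall>F c. finite F \<and> F \<subseteq> D \<longrightarrow> gaussian_rv P (\<lambda>w. \<Sum>x\<in>F. c x * Y x w))"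

definition covariance :: "'w measure \<Rightarrow> ('w \<Rightarrow> real) \<Rightarrow> ('w \<Rightarrow> real) \<Rightarrow> real" where
  "covariance P U V =
     prob_space.expectation P
       (\<lambda>w. (U w - prob_space.expectation P U) * (V w - prob_space.expectation P V))"

(* Meaningful only if invertible_mat A, in which case mat_inverse A is Some of the inverse. *)
definition inv_mat :: "real mat \<Rightarrow> real mat" where
  "inv_mat A = the (mat_inverse A)"

(* A design matrix with rows A ! 0, A ! 1, ... is represented by the list A of its rows. *)
definition kernel_mat :: "('a \<Rightarrow> 'a \<Rightarrow> real) \<Rightarrow> 'a list \<Rightarrow> 'a list \<Rightarrow> real mat" where
  "kernel_mat k A B = Matrix.mat (length A) (length B) (\<lambda>(i, j). k (A ! i) (B ! j))"

definition kriging ::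
  "('a \<Rightarrow> 'a \<Rightarrow> real) \<Rightarrow> ('a \<Rightarrow> 'w \<Rightarrow> real) \<Rightarrow> 'a list \<Rightarrow> 'a \<Rightarrow> 'w \<Rightarrow> real" where
  "kriging k Y A x w =
     scalar_prod (Matrix.row (kernel_mat k [x] A) 0)
       (mult_mat_vec (inv_mat (kernel_mat k A A))
         (Matrix.vec (length A) (\<lambda>i. Y (A ! i) w)))"

definition covariance_mat :: "'w measure \<Rightarrow> nat \<Rightarrow> (nat \<Rightarrow> 'w \<Rightarrow> real) \<Rightarrow> real mat" where
  "covariance_mat P p M = Matrix.mat p p (\<lambda>(i, j). covariance P (M i) (M j))"

definition covariance_vec ::
  "'w measure \<Rightarrow> nat \<Rightarrow> (nat \<Rightarrow> 'w \<Rightarrow> real) \<Rightarrow> ('w \<Rightarrow> real) \<Rightarrow> real Matrix.vec" where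
  "covariance_vec P p M Z = Matrix.vec p (\<lambda>i. covariance P (M i) Z)"

definition linear_predictor ::
  "'w measure \<Rightarrow> nat \<Rightarrow> (nat \<Rightarrow> 'w \<Rightarrow> real) \<Rightarrow> ('w \<Rightarrow> real) \<Rightarrow> 'w \<Rightarrow> real" where
  "linear_predictor P p M Z w =
     scalar_prod (covariance_vec P p M Z)
       (mult_mat_vec (inv_mat (covariance_mat P p M)) (Matrix.vec p (\<lambda>i. M i w)))"

definition nested_kriging ::
  "'w measure \<Rightarrow> ('a \<Rightarrow> 'a \<Rightarrow> real) \<Rightarrow> ('a \<Rightarrow> 'w \<Rightarrow> real) \<Rightarrow> nat \<Rightarrow> (nat \<Rightarrow> 'a list) \<Rightarrow>
   'a \<Rightarrow> 'w \<Rightarrow> real" where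
  "nested_kriging P k Y p A x = linear_predictor P p (\<lambda>i. kriging k Y (A i) x) (Y x)"

lemma inv_mat_inverse:
  assumes "invertible_mat A" "A \<in> carrier_mat n n"
  shows "inv_mat A \<in> carrier_mat n n" "A * inv_mat A = 1\<^sub>m n" "inv_mat A * A = 1\<^sub>m n"
proof -
  obtain B where B: "A * B = 1\<^sub>m n" "B * A = 1\<^sub>m (dim_row B)"
    using assms unfolding invertible_mat_def inverts_mat_def by auto
  have Bc: "B \<in> carrier_mat n n"
    using B assms(2) by (metis carrier_matD carrier_matI index_mult_mat(2,3) index_one_mat(2,3))
  have U: "A \<in> Units (ring_mat TYPE(real) n b)" for b :: nat
    using B Bc assms(2) unfolding Units_def ring_mat_def by auto
  then obtain C where C: "mat_inverse A = Some C"
    using mat_inverse(1)[OF assms(2), where b = "0::nat"] by (cases "mat_inverse A") auto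
  then show "inv_mat A \<in> carrier_mat n n" "A * inv_mat A = 1\<^sub>m n" "inv_mat A * A = 1\<^sub>m n"
    using mat_inverse(2)[OF assms(2) C] unfolding inv_mat_def by auto
qed

lemma linear_predictor_eq_sum:
  assumes "invertible_mat (covariance_mat P p M)"
  shows "\<exists>b. (\<forall>w. linear_predictor P p M Z w = (\<Sum>i<p. b i * M i w)) \<and>
             (\<forall>j<p. (\<Sum>i<p. b i * covariance P (M i) (M j)) = covariance P (M j) Z)"
proof -
  define K where "K = covariance_mat P p M"
  define c where "c = covariance_vec P p M Z"
  define b where "b = mult_mat_vec (transpose_mat (inv_mat K)) c"
  have Kc: "K \<in> carrier_mat p p" unfolding K_def covariance_mat_def by simp
  have cc: "c \<in> carrier_vec p" unfolding c_def covariance_vec_def by simp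
  note I = inv_mat_inverse[OF assms[folded K_def] Kc]
  have bc: "b \<in> carrier_vec p" using I cc unfolding b_def by auto
  have "linear_predictor P p M Z w = (\<Sum>i<p. vec_index b i * M i w)" for w
  proof -
    have "linear_predictor P p M Z w = scalar_prod b (Matrix.vec p (\<lambda>i. M i w))"
      unfolding linear_predictor_def b_def K_def[symmetric] c_def[symmetric]
      using transpose_vec_mult_scalar[OF I(1) _ cc, of "Matrix.vec p (\<lambda>i. M i w)"]
      by simp
    then show ?thesis by (simp add: scalar_prod_def atLeast0LessThan)
  qed
  moreover have "(\<Sum>i<p. vec_index b i * covariance P (M i) (M j)) = covariance P (M j) Z"
    if j: "j < p" for j
  proof -
    have "mult_mat_vec (transpose_mat K) b = mult_mat_vec (transpose_mat K * transpose_mat (inv_mat K)) c"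
      unfolding b_def using Kc I cc by (subst assoc_mult_mat_vec[of _ p p _ p]) auto
    also have "transpose_mat K * transpose_mat (inv_mat K) = 1\<^sub>m p"
      using transpose_mult[OF I(1) Kc] I(3) by simp
    finally have "mult_mat_vec (transpose_mat K) b = c" using cc by simp
    then have "vec_index (mult_mat_vec (transpose_mat K) b) j = vec_index c j" by simp
    then show ?thesis using j bc Kc
      by (simp add: scalar_prod_def atLeast0LessThan K_def c_def covariance_mat_def
          covariance_vec_def mult.commute)
  qed
  ultimately show ?thesis by (intro exI[of _ "vec_index b"]) auto
qed

(* Shows that the closed formula above is the best linear predictor for centred variables. *)
lemma linear_predictor_best:
  assumes "invertible_mat (covariance_mat P p M)"
    and Z: "Z \<in> borel_measurable P" "integrable P (\<lambda>w. (Z w)\<^sup>2)" "prob_space.expectation P Z = 0"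
    and M: "\<And>i. i < p \<Longrightarrow> M i \<in> borel_measurable P" "\<And>i. i < p \<Longrightarrow> integrable P (\<lambda>w. (M i w)\<^sup>2)"
      "\<And>i. i < p \<Longrightarrow> prob_space.expectation P (M i) = 0"
  shows "prob_space.expectation P (\<lambda>w. (Z w - linear_predictor P p M Z w)\<^sup>2)
       \<le> prob_space.expectation P (\<lambda>w. (Z w - (\<Sum>i<p. a i * M i w))\<^sup>2)"
proof -
  obtain b where b: "\<And>w. linear_predictor P p M Z w = (\<Sum>i<p. b i * M i w)"
    "\<And>j. j < p \<Longrightarrow> (\<Sum>i<p. b i * covariance P (M i) (M j)) = covariance P (M j) Z"
    using linear_predictor_eq_sum[OF assms(1), of Z] by blast
  have int: "integrable P (\<lambda>w. U w * V w)"
    if "U \<in> borel_measurable P" "V \<in> borel_measurable P"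
      "integrable P (\<lambda>w. (U w)\<^sup>2)" "integrable P (\<lambda>w. (V w)\<^sup>2)" for U V :: "_ \<Rightarrow> real"
  proof (rule Bochner_Integration.integrable_bound[OF Bochner_Integration.integrable_add[OF that(3,4)]])
    show "AE w in P. norm (U w * V w) \<le> norm ((U w)\<^sup>2 + (V w)\<^sup>2)"
    proof (rule AE_I2)
      fix w
      have "2 * \<bar>U w * V w\<bar> \<le> (U w)\<^sup>2 + (V w)\<^sup>2"
        using sum_squares_bound[of "\<bar>U w\<bar>" "\<bar>V w\<bar>"] by (simp add: abs_mult)
      then show "norm (U w * V w) \<le> norm ((U w)\<^sup>2 + (V w)\<^sup>2)"
        using abs_ge_zero[of "U w * V w"] by simp
    qed
  qed (use that in measurable)
  define S where "S e w = (\<Sum>i<p. e i * M i w)" for e w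
  define e where "e i = a i - b i" for i
  have Smeas: "S f \<in> borel_measurable P" for f
    unfolding S_def using M(1) by (intro borel_measurable_sum borel_measurable_times) auto
  have Sint: "integrable P (\<lambda>w. (S f w)\<^sup>2)" for f
  proof -
    have "integrable P (\<lambda>w. \<Sum>i<p. \<Sum>j<p. (f i * f j) * (M i w * M j w))"
      using M int by (intro Bochner_Integration.integrable_sum integrable_mult_right) auto
    then show ?thesis
      by (simp add: S_def power2_eq_square sum_product mult_ac)
  qed
  have ZS: "integrable P (\<lambda>w. Z w * S f w)" for f using int Z Smeas Sint by blast
  have SS: "integrable P (\<lambda>w. S f w * S g w)" for f g using int Smeas Sint by blast
  have MM: "integrable P (\<lambda>w. M i w * M j w)" if "i < p" "j < p" for i j using int M that by blast
  have MZ: "integrable P (\<lambda>w. M i w * Z w)" if "i < p" for i using int M Z that by blast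
  have dint: "integrable P (\<lambda>w. (Z w - S f w)\<^sup>2)" for f
    using Z(2) ZS[of f] Sint[of f] by (simp add: power2_diff mult.assoc)
  have orth: "(\<integral>w. (Z w - S b w) * M j w \<partial>P) = 0" if j: "j < p" for j
  proof -
    have "(\<integral>w. (Z w - S b w) * M j w \<partial>P) = (\<integral>w. M j w * Z w - (\<Sum>i<p. b i * (M i w * M j w)) \<partial>P)"
      by (simp add: S_def left_diff_distrib sum_distrib_right mult.commute[of "M j _" "Z _"] mult.assoc)
    also have "\<dots> = (\<integral>w. M j w * Z w \<partial>P) - (\<Sum>i<p. b i * (\<integral>w. M i w * M j w \<partial>P))"
      using MZ MM j by (subst Bochner_Integration.integral_diff) (auto simp: Bochner_Integration.integral_sum)
    also have "\<dots> = 0"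
      using b(2)[OF j] Z(3) M(3) j by (simp add: covariance_def)
    finally show ?thesis .
  qed
  have orthS: "(\<integral>w. (Z w - S b w) * S e w \<partial>P) = 0"
  proof -
    have "integrable P (\<lambda>w. (Z w - S b w) * M j w)" if "j < p" for j
      using int[of "\<lambda>w. Z w - S b w" "M j"] Z(1) Smeas M that dint by simp
    moreover have "(\<integral>w. (Z w - S b w) * S e w \<partial>P) = (\<integral>w. (\<Sum>j<p. e j * ((Z w - S b w) * M j w)) \<partial>P)"
      unfolding S_def[of e] sum_distrib_left by (simp add: mult_ac)
    ultimately show ?thesis using orth by (simp add: Bochner_Integration.integral_sum)
  qed
  have "(\<integral>w. (Z w - S a w)\<^sup>2 \<partial>P)
      = (\<integral>w. (Z w - S b w)\<^sup>2 + ((S e w)\<^sup>2 - 2 * ((Z w - S b w) * S e w)) \<partial>P)"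
  proof (rule Bochner_Integration.integral_cong[OF refl])
    fix w
    have "S a w = S b w + S e w"
      by (simp add: S_def e_def sum.distrib[symmetric] algebra_simps)
    then show "(Z w - S a w)\<^sup>2 = (Z w - S b w)\<^sup>2 + ((S e w)\<^sup>2 - 2 * ((Z w - S b w) * S e w))"
      by (simp add: power2_eq_square algebra_simps)
  qed
  also have "\<dots> = (\<integral>w. (Z w - S b w)\<^sup>2 \<partial>P) + ((\<integral>w. (S e w)\<^sup>2 \<partial>P) - 2 * (\<integral>w. (Z w - S b w) * S e w \<partial>P))"
    using dint Sint ZS SS
    by (simp add: left_diff_distrib)
  also have "\<dots> \<ge> (\<integral>w. (Z w - S b w)\<^sup>2 \<partial>P)"
    unfolding orthS by simp
  finally show ?thesis unfolding b(1) S_def .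
qed

end

theory Submission
  imports Defs
begin

text \<open>If \<open>u\<close> is an observation point near \<open>x\<close> and \<open>u\<close> belongs to the design \<open>X\<^sub>i\<close>, then
  two applications of best linear prediction bound the mean square error of the nested predictor
  at \<open>x\<close> by that of \<open>M\<^sub>i(x)\<close>, which is at most that of the trivial predictor \<open>Y(u)\<close>. The latter is
  \<open>k(x,x) - 2 k(x,u) + k(u,u)\<close>, which is uniformly small by uniform continuity of \<open>k\<close>, because
  on a compact set the pointwise convergence of the fill distance is uniform.\<close>

text \<open>This class contains what \<open>linear_predictor_best\<close> asks of each variable. It
  is closed under finite linear combinations (integrability lets the means add up), and on it a
  covariance is the integral of a product.\<close>

definition centred_L2 :: "'w measure \<Rightarrow> ('w \<Rightarrow> real) \<Rightarrow> bool" where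
  "centred_L2 P Z \<longleftrightarrow> Z \<in> borel_measurable P \<and> integrable P Z \<and>
     integrable P (\<lambda>w. (Z w)\<^sup>2) \<and> (\<integral>w. Z w \<partial>P) = 0"

lemma integrable_mult_of_squares:
  fixes U V :: "'w \<Rightarrow> real"
  assumes "U \<in> borel_measurable P" "V \<in> borel_measurable P"
    and "integrable P (\<lambda>w. (U w)\<^sup>2)" "integrable P (\<lambda>w. (V w)\<^sup>2)"
  shows "integrable P (\<lambda>w. U w * V w)"
proof (rule Bochner_Integration.integrable_bound[OF Bochner_Integration.integrable_add[OF assms(3,4)]])
  show "AE w in P. norm (U w * V w) \<le> norm ((U w)\<^sup>2 + (V w)\<^sup>2)"
  proof (rule AE_I2)
    fix w
    have "2 * \<bar>U w * V w\<bar> \<le> (U w)\<^sup>2 + (V w)\<^sup>2"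
      using sum_squares_bound[of "\<bar>U w\<bar>" "\<bar>V w\<bar>"] by (simp add: abs_mult)
    then show "norm (U w * V w) \<le> norm ((U w)\<^sup>2 + (V w)\<^sup>2)"
      using abs_ge_zero[of "U w * V w"] by simp
  qed
qed (use assms in measurable)

lemma centred_L2_sum:
  assumes "\<And>i. i \<in> I \<Longrightarrow> centred_L2 P (Z i)"
  shows "centred_L2 P (\<lambda>w. \<Sum>i\<in>I. c i * Z i w)"
proof -
  have "integrable P (\<lambda>w. Z i w * Z j w)" if "i \<in> I" "j \<in> I" for i j
    using assms that by (intro integrable_mult_of_squares) (auto simp: centred_L2_def)
  then have "integrable P (\<lambda>w. \<Sum>i\<in>I. \<Sum>j\<in>I. (c i * c j) * (Z i w * Z j w))"
    by (intro Bochner_Integration.integrable_sum integrable_mult_right) auto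
  then have "integrable P (\<lambda>w. (\<Sum>i\<in>I. c i * Z i w)\<^sup>2)"
    by (simp add: power2_eq_square sum_product mult_ac)
  moreover have "(\<lambda>w. \<Sum>i\<in>I. c i * Z i w) \<in> borel_measurable P"
    using assms by (intro borel_measurable_sum borel_measurable_times) (auto simp: centred_L2_def)
  ultimately show ?thesis
    using assms by (auto simp: centred_L2_def Bochner_Integration.integral_sum
        intro!: Bochner_Integration.integrable_sum)
qed

lemma (in prob_space) gaussian_rv_square_integrable:
  assumes "gaussian_rv M Z"
  shows "integrable M (\<lambda>w. (Z w)\<^sup>2)"
proof -
  have meas: "Z \<in> borel_measurable M" using assms by (simp add: gaussian_rv_def)
  consider m where "AE w in M. Z w = m"
    | m s where "s > 0" "distributed M lborel Z (\<lambda>t. ennreal (normal_density m s t))"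
    using assms by (auto simp: gaussian_rv_def)
  then show ?thesis
  proof cases
    case 1
    then have "AE w in M. (Z w)\<^sup>2 = m\<^sup>2" by (auto elim: eventually_mono)
    then have "integrable M (\<lambda>w. (Z w)\<^sup>2) \<longleftrightarrow> integrable M (\<lambda>w. m\<^sup>2)"
      using meas by (intro integrable_cong_AE) auto
    then show ?thesis by simp
  next
    case 2
    have "integrable lborel (\<lambda>t. normal_density m s t * t ^ 2)"
    proof -
      \<comment> \<open>The second moment is rewritten through central moments, whose integrability
        is known: \<open>t^2 = (t - m)^2 + 2 * m * (t - m) + m^2\<close>.\<close>
      have "integrable lborel (\<lambda>t. normal_density m s t * (t - m) ^ 2
          + (2 * m * (normal_density m s t * (t - m) ^ 1) + m\<^sup>2 * normal_density m s t))"
        using integrable_normal_moment[OF 2(1), of m 2] integrable_normal_moment[OF 2(1), of m 1] 2(1)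
        by (intro Bochner_Integration.integrable_add integrable_mult_right) auto
      then show ?thesis by (simp add: power2_eq_square algebra_simps)
    qed
    then show ?thesis
      using distributed_integrable[OF 2(2), of "\<lambda>t. t\<^sup>2"] by simp
  qed
qed

lemma (in prob_space) gaussian_process_centred_L2:
  assumes "gaussian_process M D Y" "x \<in> D" "expectation (Y x) = 0"
  shows "centred_L2 M (Y x)"
proof -
  \<comment> \<open>Each marginal is the linear combination over a single point with coefficient
    1.\<close>
  have "gaussian_rv M (\<lambda>w. \<Sum>z\<in>{x}. 1 * Y z w)"
    using assms(1,2) unfolding gaussian_process_def
    by (elim conjE allE[of _ "{x}"] allE[of _ "\<lambda>_. 1"]) auto
  then have g: "gaussian_rv M (Y x)" by simp
  then have "Y x \<in> borel_measurable M" by (simp add: gaussian_rv_def)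
  then show ?thesis
    using gaussian_rv_square_integrable[OF g] assms(3)
    by (auto simp: centred_L2_def intro: square_integrable_imp_integrable)
qed

lemma covariance_commute: "covariance P U V = covariance P V U"
  by (simp add: covariance_def mult.commute)

lemma (in prob_space) expectation_diff_square:
  assumes "centred_L2 M U" "centred_L2 M V"
  shows "expectation (\<lambda>w. (U w - V w)\<^sup>2) = covariance M U U - 2 * covariance M U V + covariance M V V"
proof -
  have "integrable M (\<lambda>w. U w * V w)"
    using assms by (intro integrable_mult_of_squares) (auto simp: centred_L2_def)
  then have "expectation (\<lambda>w. (U w)\<^sup>2 + (V w)\<^sup>2 - 2 * (U w * V w))
      = expectation (\<lambda>w. (U w)\<^sup>2) + expectation (\<lambda>w. (V w)\<^sup>2) - 2 * expectation (\<lambda>w. U w * V w)"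
    using assms by (simp add: centred_L2_def)
  then show ?thesis
    using assms by (simp add: centred_L2_def covariance_def power2_diff mult.assoc)
      (simp add: power2_eq_square)
qed

text \<open>The predictor is a linear combination of the \<open>M i\<close>, whatever
  \<open>Z\<close> is. This allows Kriging predictors to serve in turn as the data of the nested
  predictor.\<close>

lemma centred_L2_linear_predictor:
  assumes "invertible_mat (covariance_mat P p M)" "\<And>i. i < p \<Longrightarrow> centred_L2 P (M i)"
  shows "centred_L2 P (linear_predictor P p M Z)"
proof -
  obtain b where "\<And>w. linear_predictor P p M Z w = (\<Sum>i<p. b i * M i w)"
    using linear_predictor_eq_sum[OF assms(1), of Z] by blast
  then have "linear_predictor P p M Z = (\<lambda>w. \<Sum>i<p. b i * M i w)" by auto
  then show ?thesis using centred_L2_sum[of "{..<p}" P M b] assms(2) by simp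
qed

text \<open>A single \<open>M j\<close> is itself a linear combination of the data, with Kronecker
  coefficients, so it cannot beat the best one. Both levels of the nesting are handled by this
  inequality.\<close>

lemma linear_predictor_error_le_single:
  assumes "invertible_mat (covariance_mat P p M)"
    and "centred_L2 P Z" "\<And>i. i < p \<Longrightarrow> centred_L2 P (M i)" "j < p"
  shows "(\<integral>w. (Z w - linear_predictor P p M Z w)\<^sup>2 \<partial>P) \<le> (\<integral>w. (Z w - M j w)\<^sup>2 \<partial>P)"
proof -
  have "(\<Sum>i<p. of_bool (i = j) * M i w) = M j w" for w
  proof -
    have "(\<Sum>i<p. of_bool (i = j) * M i w) = (\<Sum>i<p. if i = j then M i w else 0)"
      by (intro sum.cong) auto
    then show ?thesis using assms(4) by simp
  qed
  moreover have "(\<integral>w. (Z w - linear_predictor P p M Z w)\<^sup>2 \<partial>P)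
      \<le> (\<integral>w. (Z w - (\<Sum>i<p. of_bool (i = j) * M i w))\<^sup>2 \<partial>P)"
    using assms(2,3) by (intro linear_predictor_best[OF assms(1)]) (auto simp: centred_L2_def)
  ultimately show ?thesis by simp
qed

context
  fixes P :: "'w measure" and k :: "'a \<Rightarrow> 'a \<Rightarrow> real" and Y :: "'a \<Rightarrow> 'w \<Rightarrow> real" and D A
  assumes k: "\<And>x y. x \<in> D \<Longrightarrow> y \<in> D \<Longrightarrow> k x y = covariance P (Y x) (Y y)"
    and A: "set A \<subseteq> D"
begin

lemma kernel_mat_eq_covariance_mat:
  "kernel_mat k A A = covariance_mat P (length A) (\<lambda>i. Y (A ! i))"
  using A by (intro eq_matI) (auto simp: kernel_mat_def covariance_mat_def k subset_iff)

text \<open>The Kriging formula is the formula of the best linear predictor with the observations as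
  data, once kernel values on \<open>D\<close> are read as covariances. Optimality thus carries over
  to each Kriging predictor.\<close>

lemma kriging_eq_linear_predictor:
  assumes "x \<in> D"
  shows "kriging k Y A x = linear_predictor P (length A) (\<lambda>i. Y (A ! i)) (Y x)"
proof -
  have "Matrix.row (kernel_mat k [x] A) 0 = covariance_vec P (length A) (\<lambda>i. Y (A ! i)) (Y x)"
    using A assms
    by (intro eq_vecI) (auto simp: kernel_mat_def covariance_vec_def k subset_iff covariance_commute)
  then show ?thesis
    by (auto simp: kriging_def linear_predictor_def kernel_mat_eq_covariance_mat)
qed

end

lemma nested_kriging_error_le:
  assumes k: "\<And>x y. x \<in> D \<Longrightarrow> y \<in> D \<Longrightarrow> k x y = covariance P (Y x) (Y y)"
    and Y: "\<And>x. x \<in> D \<Longrightarrow> centred_L2 P (Y x)"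
    and A: "\<And>i. i < p \<Longrightarrow> set (A i) \<subseteq> D"
    and inv: "\<And>i. i < p \<Longrightarrow> invertible_mat (kernel_mat k (A i) (A i))"
    and inv_nested: "invertible_mat (covariance_mat P p (\<lambda>i. kriging k Y (A i) x))"
    and x: "x \<in> D" and i: "i < p" and u: "u \<in> set (A i)"
  shows "(\<integral>w. (Y x w - nested_kriging P k Y p A x w)\<^sup>2 \<partial>P) \<le> (\<integral>w. (Y x w - Y u w)\<^sup>2 \<partial>P)"
proof -
  have inv': "invertible_mat (covariance_mat P (length (A l)) (\<lambda>j. Y (A l ! j)))" if "l < p" for l
    using inv[OF that] kernel_mat_eq_covariance_mat[of D k P Y "A l"] k A[OF that] by simp
  have krig: "kriging k Y (A l) x = linear_predictor P (length (A l)) (\<lambda>j. Y (A l ! j)) (Y x)"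
    if "l < p" for l
    using kriging_eq_linear_predictor[of D k P Y "A l"] k A[OF that] x by blast
  have cY: "centred_L2 P (Y (A l ! j))" if "l < p" "j < length (A l)" for l j
    using Y A[OF that(1)] that(2) by (simp add: subset_iff)
  \<comment> \<open>Outer level: the data are the Kriging predictors, and the competitor is the one
    whose design contains \<open>u\<close>.\<close>
  have "(\<integral>w. (Y x w - nested_kriging P k Y p A x w)\<^sup>2 \<partial>P) \<le> (\<integral>w. (Y x w - kriging k Y (A i) x w)\<^sup>2 \<partial>P)"
    unfolding nested_kriging_def
    by (intro linear_predictor_error_le_single[OF inv_nested Y[OF x] _ i])
      (simp add: krig inv' cY centred_L2_linear_predictor)
  also obtain j where j: "j < length (A i)" "u = A i ! j" using u by (auto simp: in_set_conv_nth)
  \<comment> \<open>Inner level: the data are the observations in that design, and the competitor is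
    the observation at \<open>u\<close>.\<close>
  have "(\<integral>w. (Y x w - kriging k Y (A i) x w)\<^sup>2 \<partial>P) \<le> (\<integral>w. (Y x w - Y u w)\<^sup>2 \<partial>P)"
    unfolding krig[OF i] j(2)
    using linear_predictor_error_le_single[OF inv'[OF i] Y[OF x] cY[OF i] j(1)] by simp
  finally show ?thesis .
qed

text \<open>Pointwise convergence holds simultaneously at the finitely many centres of an
  \<open>e / 2\<close>-net of \<open>D\<close>, and the triangle inequality carries it to all of
  \<open>D\<close>.\<close>

lemma fill_distance_uniform:
  fixes D :: "'a::real_normed_vector set" and xs :: "nat \<Rightarrow> nat \<Rightarrow> 'a"
  assumes "compact D" "e > 0"
    and lim: "\<And>x. x \<in> D \<Longrightarrow> (\<lambda>n. Min ((\<lambda>i. norm (xs n i - x)) ` {1..n})) \<longlonglongrightarrow> 0"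
  shows "\<forall>\<^sub>F n in sequentially. \<forall>x\<in>D. \<exists>i\<in>{1..n}. norm (xs n i - x) < e"
proof -
  obtain C where C: "finite C" "C \<subseteq> D" "D \<subseteq> (\<Union>c\<in>C. ball c (e / 2))"
    using seq_compact_imp_totally_bounded[of D] assms(1,2) compact_imp_seq_compact half_gt_zero by metis
  have "\<forall>\<^sub>F n in sequentially. \<forall>c\<in>C. Min ((\<lambda>i. norm (xs n i - c)) ` {1..n}) < e / 2"
  proof (rule eventually_ball_finite[OF C(1)], rule ballI)
    fix c assume "c \<in> C"
    then have "c \<in> D" using C(2) by blast
    from order_tendstoD(2)[OF lim[OF this], of "e / 2"]
    show "\<forall>\<^sub>F n in sequentially. Min ((\<lambda>i. norm (xs n i - c)) ` {1..n}) < e / 2"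
      using assms(2) by simp
  qed
  then show ?thesis
    \<comment> \<open>For \<open>n \<ge> 1\<close> the index set is nonempty, so \<open>Min\<close>
      is an actual minimum attained at some index.\<close>
    using eventually_ge_at_top[of 1]
  proof eventually_elim
    case (elim n)
    show ?case
    proof
      fix x assume "x \<in> D"
      then obtain c where c: "c \<in> C" "dist c x < e / 2" using C(3) by auto
      obtain i where i: "i \<in> {1..n}" "norm (xs n i - c) < e / 2"
        using elim c(1) by (subst (asm) Min_less_iff) auto
      have "norm (xs n i - x) < e"
        using i(2) c(2) norm_triangle_ineq[of "xs n i - c" "c - x"] by (simp add: dist_norm)
      then show "\<exists>i\<in>{1..n}. norm (xs n i - x) < e" using i(1) by blast
    qed
  qed
qed

text \<open>The expression splits as \<open>(k x x - k x y) + (k y y - k x y)\<close>, and uniform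
  continuity makes each difference smaller than \<open>e / 2\<close>. For a centred process with
  covariance \<open>k\<close> it is the mean square of the increment between \<open>x\<close> and
  \<open>y\<close>.\<close>

lemma kernel_variogram_uniformly_small:
  fixes k :: "'a::metric_space \<Rightarrow> 'a \<Rightarrow> real"
  assumes "compact D" "continuous_on (D \<times> D) (\<lambda>(x, y). k x y)" "e > 0"
  shows "\<exists>d>0. \<forall>x\<in>D. \<forall>y\<in>D. dist x y < d \<longrightarrow> k x x - 2 * k x y + k y y < e"
proof -
  have "uniformly_continuous_on (D \<times> D) (\<lambda>(x, y). k x y)"
    using assms(1,2) by (intro compact_uniformly_continuous compact_Times)
  then obtain d where d: "d > 0"
    "\<And>z z'. z \<in> D \<times> D \<Longrightarrow> z' \<in> D \<times> D \<Longrightarrow> dist z' z < d \<Longrightarrow>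
       dist ((\<lambda>(x, y). k x y) z') ((\<lambda>(x, y). k x y) z) < e / 2"
    using assms(3) unfolding uniformly_continuous_on_def by (meson half_gt_zero)
  have "k x x - 2 * k x y + k y y < e" if "x \<in> D" "y \<in> D" "dist x y < d" for x y
    \<comment> \<open>The pairs \<open>(x, x)\<close> and \<open>(y, y)\<close> both lie at distance
      \<open>dist x y\<close> from \<open>(x, y)\<close>.\<close>
    using d(2)[of "(x, y)" "(x, x)"] d(2)[of "(x, y)" "(y, y)"] that
    by (simp add: dist_Pair_Pair dist_real_def abs_if dist_commute split: if_splits)
  then show ?thesis using d(1) by blast
qed

theorem proposition2:
  fixes D :: "(real ^ 'd) set"
    and P :: "'w measure"
    and Y :: "real ^ 'd \<Rightarrow> 'w \<Rightarrow> real"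
    and k :: "real ^ 'd \<Rightarrow> real ^ 'd \<Rightarrow> real"
    and xs :: "nat \<Rightarrow> nat \<Rightarrow> real ^ 'd"
    and p :: "nat \<Rightarrow> nat"
    and X :: "nat \<Rightarrow> nat \<Rightarrow> (real ^ 'd) list"
  assumes "compact D" and "D \<noteq> {}"
    and "gaussian_process P D Y"
    and "\<And>x. x \<in> D \<Longrightarrow> prob_space.expectation P (Y x) = 0"
    and "\<And>x y. x \<in> D \<Longrightarrow> y \<in> D \<Longrightarrow> k x y = covariance P (Y x) (Y y)"
    and "continuous_on (D \<times> D) (\<lambda>(x, y). k x y)"
    and "\<And>n i. i \<in> {1..n} \<Longrightarrow> xs n i \<in> D"
    and "\<And>x. x \<in> D \<Longrightarrow> (\<lambda>n. Min ((\<lambda>i. norm (xs n i - x)) ` {1..n})) \<longlonglongrightarrow> 0"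
    and "\<And>n i. n \<ge> 1 \<Longrightarrow> i < p n \<Longrightarrow> set (X n i) \<subseteq> xs n ` {1..n}"
    and "\<And>n j. n \<ge> 1 \<Longrightarrow> j \<in> {1..n} \<Longrightarrow> \<exists>i<p n. xs n j \<in> set (X n i)"
    and "\<And>n i. n \<ge> 1 \<Longrightarrow> i < p n \<Longrightarrow> invertible_mat (kernel_mat k (X n i) (X n i))"
    and "\<And>n x. n \<ge> 1 \<Longrightarrow> x \<in> D \<Longrightarrow>
           invertible_mat (covariance_mat P (p n) (\<lambda>i. kriging k Y (X n i) x))"
  shows "(\<lambda>n. SUP x\<in>D. ereal (prob_space.expectation P
           (\<lambda>w. (Y x w - nested_kriging P k Y (p n) (X n) x w)\<^sup>2))) \<longlonglongrightarrow> 0"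
proof (rule order_tendstoI)
  interpret prob_space P using assms(3) by (simp add: gaussian_process_def)
  let ?E = "\<lambda>n x. expectation (\<lambda>w. (Y x w - nested_kriging P k Y (p n) (X n) x w)\<^sup>2)"
  have Y: "centred_L2 P (Y x)" if "x \<in> D" for x
    using gaussian_process_centred_L2[OF assms(3) that assms(4)[OF that]] .
  {
    fix a :: ereal assume "a < 0"
    obtain x where "x \<in> D" using assms(2) by blast
    \<comment> \<open>A point of \<open>D\<close> is used here because the supremum of the empty set
      in \<open>ereal\<close> is minus infinity.\<close>
    have "0 \<le> (SUP x\<in>D. ereal (?E n x))" for n
      by (rule SUP_upper2[OF \<open>x \<in> D\<close>]) simp
    then show "\<forall>\<^sub>F n in sequentially. a < (SUP x\<in>D. ereal (?E n x))"
      by (intro always_eventually allI less_le_trans[OF \<open>a < 0\<close>])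
  next
    fix a :: ereal assume "0 < a"
    \<comment> \<open>A real \<open>e\<close> strictly below \<open>a\<close> leaves room for the
      supremum, which inherits only a weak inequality from the pointwise bounds; it also covers an
      infinite \<open>a\<close>.\<close>
    then obtain e where e: "0 < ereal e" "ereal e < a" using ereal_dense2[OF \<open>0 < a\<close>] by blast
    then obtain d where d: "d > 0"
      "\<And>x y. x \<in> D \<Longrightarrow> y \<in> D \<Longrightarrow> dist x y < d \<Longrightarrow> k x x - 2 * k x y + k y y < e"
      using kernel_variogram_uniformly_small[OF assms(1,6), of e] by auto
    have "\<forall>\<^sub>F n in sequentially. \<forall>x\<in>D. \<exists>i\<in>{1..n}. norm (xs n i - x) < d"
      by (rule fill_distance_uniform[OF assms(1) d(1)]) (rule assms(8))
    then show "\<forall>\<^sub>F n in sequentially. (SUP x\<in>D. ereal (?E n x)) < a"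
      \<comment> \<open>The hypotheses on the designs concern \<open>n \<ge> 1\<close> only.\<close>
      using eventually_ge_at_top[of 1]
    proof eventually_elim
      case (elim n)
      have "?E n x \<le> e" if x: "x \<in> D" for x
      proof -
        obtain j where j: "j \<in> {1..n}" "norm (xs n j - x) < d" using elim(1) x by blast
        \<comment> \<open>The designs cover all observation points. The indices \<open>j\<close> and
          \<open>i\<close> vary with \<open>x\<close>, but the resulting bound \<open>e\<close> does
          not.\<close>
        then obtain i where i: "i < p n" "xs n j \<in> set (X n i)" using assms(10) elim(2) by blast
        have u: "xs n j \<in> D" using assms(7) j(1) by blast
        have sub: "set (X n l) \<subseteq> D" if "l < p n" for l
          using assms(9)[OF elim(2) that] assms(7) by blast
        have "?E n x \<le> expectation (\<lambda>w. (Y x w - Y (xs n j) w)\<^sup>2)"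
          using nested_kriging_error_le[where D = D, OF assms(5) Y sub assms(11)[OF elim(2)]
              assms(12)[OF elim(2) x] x i] .
        also have "\<dots> = k x x - 2 * k x (xs n j) + k (xs n j) (xs n j)"
          using expectation_diff_square[OF Y[OF x] Y[OF u]] assms(5) x u by simp
        also have "\<dots> \<le> e"
          using d(2)[OF x u] j(2) by (simp add: dist_norm norm_minus_commute)
        finally show ?thesis .
      qed
      then have "(SUP x\<in>D. ereal (?E n x)) \<le> ereal e" by (intro SUP_least) simp
      then show ?case using e(2) by simp
    qed
  }
qed

end
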